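(* Let $M$ be a monoid with unique left inverses and let $H$ be a finitely generated group. Then the word problem for $H$ is accepted by a deterministic $M$-automaton if and only if $H$ has a finite index subgroup which embeds in the group of units of $M$.
   Context: Let $M$ be a monoid with identity $1$ and $X$ a finite alphabet. $M$ has unique left inverses if whenever $a,b,c\in M$ satisfy $ba=1=ca$, then $b=c$. The group of units of $M$ is the group of elements of $M$ having a two-sided inverse with respect to $1$. An $M$-automaton $A$ over $X$ is a finite automaton over the monoid $M\times X^*$: it has a finite set of states, one initial state, a set of terminal states, and finitely many directed edges labelled by elements of $M\times X^*$. The label of a (directed) path is the product in $M\times X^*$ of its edge labels in order (the empty path at any state has label $(1,\varepsilon)$). $A$ accepts a word $w\in X^*$ if there is a path from the initial state to a terminal state labelled $(1,w)$. The language accepted by $A$ is the set of all words it accepts. $A$ is deterministic if all its edges are labelled by elements of $M\times X$, and for every state $q$ and letter $x\in X$ there is at most one edge leaving $q$ with a label of the form $(g,x)$ with $g\in M$. If $H$ is a group generated as a monoid by a finite subset $X$, the word problem for $H$ (with respect to $X$) is the set of all words in the free monoid $X^*$ which represent the identity of $H$. Here $X$ is any fixed finite monoid generating set of $H$. *)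

theory Defs
  imports "HOL-Algebra.Coset"
begin

definition unique_left_inverses :: "('m, 'b) monoid_scheme \<Rightarrow> bool" where
  "unique_left_inverses M \<longleftrightarrow>
     (\<forall>a\<in>carrier M. \<forall>b\<in>carrier M. \<forall>c\<in>carrier M.
        b \<otimes>\<^bsub>M\<^esub> a = \<one>\<^bsub>M\<^esub> \<and> c \<otimes>\<^bsub>M\<^esub> a = \<one>\<^bsub>M\<^esub> \<longrightarrow> b = c)"

definition free_monoid :: "'x set \<Rightarrow> 'x list monoid" where
  "free_monoid X = \<lparr>carrier = lists X, mult = (@), one = []\<rparr>"

definition list_product :: "('n, 'b) monoid_scheme \<Rightarrow> 'n list \<Rightarrow> 'n" where
  "list_product N ns = foldr (\<lambda>m n. m \<otimes>\<^bsub>N\<^esub> n) ns \<one>\<^bsub>N\<^esub>"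

text \<open>An edge \<open>(p, n, q)\<close> leads from \<open>p\<close> to \<open>q\<close> and is labelled by \<open>n\<close>.\<close>

record ('q, 'n) automaton =
  states :: "'q set"
  init :: 'q
  terminals :: "'q set"
  edges :: "('q \<times> 'n \<times> 'q) set"

definition finite_automaton_over ::
    "('n, 'b) monoid_scheme \<Rightarrow> ('q, 'n) automaton \<Rightarrow> bool" where
  "finite_automaton_over N A \<longleftrightarrow>
     finite (states A) \<and> init A \<in> states A \<and> terminals A \<subseteq> states A \<and>
     finite (edges A) \<and> edges A \<subseteq> states A \<times> carrier N \<times> states A"

fun is_path :: "('q, 'n) automaton \<Rightarrow> 'q \<Rightarrow> ('q \<times> 'n \<times> 'q) list \<Rightarrow> 'q \<Rightarrow> bool" where
  "is_path A p [] q \<longleftrightarrow> p \<in> states A \<and> q = p"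
| "is_path A p (e # es) q \<longleftrightarrow>
     e \<in> edges A \<and> fst e = p \<and> is_path A (snd (snd e)) es q"

definition path_label ::
    "('n, 'b) monoid_scheme \<Rightarrow> ('q \<times> 'n \<times> 'q) list \<Rightarrow> 'n" where
  "path_label N es = list_product N (map (\<lambda>(p, n, q). n) es)"

definition M_automaton ::
    "('m, 'b) monoid_scheme \<Rightarrow> 'x set \<Rightarrow> ('q, 'm \<times> 'x list) automaton \<Rightarrow> bool" where
  "M_automaton M X A \<longleftrightarrow> finite_automaton_over (M \<times>\<times> free_monoid X) A"

definition accepts ::
    "('m, 'b) monoid_scheme \<Rightarrow> 'x set \<Rightarrow> ('q, 'm \<times> 'x list) automaton \<Rightarrow> 'x list \<Rightarrow> bool" where
  "accepts M X A w \<longleftrightarrow>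
     (\<exists>t\<in>terminals A. \<exists>es. is_path A (init A) es t \<and>
        path_label (M \<times>\<times> free_monoid X) es = (\<one>\<^bsub>M\<^esub>, w))"

definition accepted_language ::
    "('m, 'b) monoid_scheme \<Rightarrow> 'x set \<Rightarrow> ('q, 'm \<times> 'x list) automaton \<Rightarrow> 'x list set" where
  "accepted_language M X A = {w \<in> lists X. accepts M X A w}"

text \<open>Elements of \<open>X\<close> are identified with the words of length one. Uniqueness concerns the
  whole edge: its monoid component and its target are both determined by state and letter.\<close>

definition deterministic ::
    "('m, 'b) monoid_scheme \<Rightarrow> 'x set \<Rightarrow> ('q, 'm \<times> 'x list) automaton \<Rightarrow> bool" where
  "deterministic M X A \<longleftrightarrow>
     (\<forall>(p, n, q)\<in>edges A. \<exists>g\<in>carrier M. \<exists>x\<in>X. n = (g, [x])) \<and>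
     (\<forall>p\<in>states A. \<forall>x\<in>X. \<forall>g g' q q'.
        (p, (g, [x]), q) \<in> edges A \<and> (p, (g', [x]), q') \<in> edges A \<longrightarrow> g = g' \<and> q = q')"

definition generates_as_monoid :: "('h, 'b) monoid_scheme \<Rightarrow> 'h set \<Rightarrow> bool" where
  "generates_as_monoid H X \<longleftrightarrow>
     X \<subseteq> carrier H \<and> (\<forall>h\<in>carrier H. \<exists>w\<in>lists X. list_product H w = h)"

definition word_problem :: "('h, 'b) monoid_scheme \<Rightarrow> 'h set \<Rightarrow> 'h list set" where
  "word_problem H X = {w \<in> lists X. list_product H w = \<one>\<^bsub>H\<^esub>}"

end

theory Submission
  imports Defs
begin

text \<open>
  Suppose a deterministic automaton accepts the word problem. Every word extends to a word
  representing the identity, so every word can be read from every reachable state. Among the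
  reachable states choose a recurrent state \<open>p\<close> reached by a word \<open>u\<close> of the word problem,
  with label \<open>\<one>\<close>. The elements of \<open>H\<close> represented by loops at \<open>p\<close> form a submonoid \<open>K\<close>, finitely
  many translates of which cover \<open>H\<close>; this forces \<open>K\<close> to be a subgroup of finite index. If two
  loops \<open>v\<close>, \<open>w\<close> represent the same element and \<open>z\<close> represents its inverse, then the labels of \<open>v\<close>
  and \<open>w\<close> are both left inverses of the label of \<open>z\<close>, hence equal; conversely the label determines
  the element. So labels embed \<open>K\<close> into the units of \<open>M\<close>.

  For the converse, take the Schreier automaton on the right cosets \<open>C\<close> of \<open>K\<close> with representatives
  \<open>r C\<close>, the edge leaving \<open>C\<close> with letter \<open>x\<close> being labelled by \<open>f (r C \<cdot> x \<cdot> (r (C x))\<inverse>)\<close>.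
\<close>

section \<open>Products of lists\<close>

lemma list_product_Nil [simp]: "list_product N [] = \<one>\<^bsub>N\<^esub>"
  by (simp add: list_product_def)

lemma list_product_Cons [simp]: "list_product N (n # ns) = n \<otimes>\<^bsub>N\<^esub> list_product N ns"
  by (simp add: list_product_def)

lemma (in monoid) list_product_closed [simp, intro]:
  "w \<in> lists (carrier G) \<Longrightarrow> list_product G w \<in> carrier G"
  by (induction w) auto

lemma (in monoid) list_product_append:
  assumes "v \<in> lists (carrier G)" and "w \<in> lists (carrier G)"
  shows "list_product G (v @ w) = list_product G v \<otimes> list_product G w"
  using assms by (induction v) (auto simp: m_assoc)

section \<open>Submonoids with finitely many covering translates\<close>

text \<open>The strict part \<open>?S\<close> of a transitive relation is asymmetric and transitive,
  so it has a maximal element on a finite nonempty set. It serves twice: for the representatives of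
  a finite cover and for the reachable states of an automaton.\<close>

lemma finite_preorder_has_maximal:
  assumes "finite A" and "A \<noteq> {}"
    and trans: "\<And>a b c. \<lbrakk>a \<in> A; b \<in> A; c \<in> A; R a b; R b c\<rbrakk> \<Longrightarrow> R a c"
  shows "\<exists>m\<in>A. \<forall>a\<in>A. R m a \<longrightarrow> R a m"
proof -
  let ?S = "\<lambda>a b. R a b \<and> \<not> R b a"
  have "asymp_on A ?S"
    by (auto simp: asymp_on_def)
  moreover have "transp_on A ?S"
    unfolding transp_on_def using trans by blast
  ultimately have "\<exists>m\<in>A. \<forall>a\<in>A. a \<noteq> m \<longrightarrow> \<not> ?S m a"
    using assms(1,2) by (intro Finite_Set.bex_max_element)
  then show ?thesis
    by metis
qed

text \<open>The right-invariant preorder \<open>a \<in> S b\<close> has a maximal element because finitely many elements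
  dominate all others; by homogeneity every element is maximal, so the preorder is symmetric.\<close>

lemma (in group) submonoid_finite_cover:
  assumes S: "S \<subseteq> carrier G" and one: "\<one> \<in> S"
    and mult: "\<And>a b. \<lbrakk>a \<in> S; b \<in> S\<rbrakk> \<Longrightarrow> a \<otimes> b \<in> S"
    and R: "finite R" "R \<subseteq> carrier G"
    and cover: "carrier G \<subseteq> (\<Union>r\<in>R. S #> r)"
  shows "subgroup S G" and "finite (rcosets S)"
proof -
  have coset: "a \<in> S #> b \<longleftrightarrow> a \<otimes> inv b \<in> S" if "a \<in> carrier G" "b \<in> carrier G" for a b
  proof
    assume "a \<in> S #> b"
    then obtain s where "s \<in> S" "a = s \<otimes> b"
      by (auto simp: r_coset_def)
    then show "a \<otimes> inv b \<in> S"
      using that S by (auto simp: m_assoc)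
  next
    assume "a \<otimes> inv b \<in> S"
    moreover have "a = (a \<otimes> inv b) \<otimes> b"
      using that by (simp add: m_assoc)
    ultimately show "a \<in> S #> b"
      unfolding r_coset_def by blast
  qed
  have trans: "a \<otimes> inv c \<in> S"
    if "a \<otimes> inv b \<in> S" "b \<otimes> inv c \<in> S" "a \<in> carrier G" "b \<in> carrier G" "c \<in> carrier G" for a b c
  proof -
    have "(a \<otimes> inv b) \<otimes> (b \<otimes> inv c) = a \<otimes> inv c"
      using that(3-5) by (metis inv_closed inv_solve_right l_inv l_one m_assoc m_closed)
    then show ?thesis
      using mult that(1,2) by metis
  qed
  have "R \<noteq> {}"
    using cover by auto
  then have "\<exists>r\<in>R. \<forall>a\<in>R. r \<otimes> inv a \<in> S \<longrightarrow> a \<otimes> inv r \<in> S"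
    by (intro finite_preorder_has_maximal) (use R in \<open>auto intro: trans[OF _ _ subsetD subsetD subsetD]\<close>)
  then obtain r where r: "r \<in> R" and max: "\<And>a. \<lbrakk>a \<in> R; r \<otimes> inv a \<in> S\<rbrakk> \<Longrightarrow> a \<otimes> inv r \<in> S"
    by blast
  have inv: "inv s \<in> S" if s: "s \<in> S" for s
  proof -
    have sG: "s \<in> carrier G" and rG: "r \<in> carrier G"
      using s S r R by auto
    \<comment> \<open>This \<open>b\<close> lies above \<open>r\<close> in the preorder, as
      \<open>r \<otimes> inv b = s\<close>. Some \<open>a\<close> in \<open>R\<close> lies above
      \<open>b\<close>, hence above \<open>r\<close>; maximality of \<open>r\<close> puts
      \<open>a\<close> below \<open>r\<close>, so \<open>b\<close> is below \<open>r\<close> too,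
      and \<open>b \<otimes> inv r\<close> is exactly \<open>inv s\<close>.\<close>
    define b where "b = inv s \<otimes> r"
    have bG: "b \<in> carrier G"
      using sG rG by (simp add: b_def)
    have "r \<otimes> inv b = s"
      using sG rG by (simp add: b_def inv_mult_group m_assoc[symmetric])
    moreover obtain a where a: "a \<in> R" and "b \<in> S #> a"
      using cover bG by blast
    then have ba: "b \<otimes> inv a \<in> S"
      using coset bG R by blast
    ultimately have "r \<otimes> inv a \<in> S"
      using trans[of r b a] s a R bG rG by auto
    then have "a \<otimes> inv r \<in> S"
      by (rule max[OF a])
    then have "b \<otimes> inv r \<in> S"
      using trans[of b a r] ba a R bG rG by auto
    then show ?thesis
      using sG rG by (simp add: b_def m_assoc)
  qed
  show sub: "subgroup S G"
    using S one mult inv by (auto intro!: subgroup.intro)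
  have "rcosets S \<subseteq> (\<lambda>r. S #> r) ` R"
  proof
    fix C
    assume "C \<in> rcosets S"
    then obtain a where a: "a \<in> carrier G" "C = S #> a"
      by (auto simp: RCOSETS_def)
    then obtain r where "r \<in> R" "a \<in> S #> r"
      using cover by blast
    then show "C \<in> (\<lambda>r. S #> r) ` R"
      using a R repr_independence[OF _ _ sub, of a r] by auto
  qed
  then show "finite (rcosets S)"
    by (rule finite_surj[OF R(1)])
qed

section \<open>Runs of deterministic automata\<close>

text \<open>In a deterministic automaton each edge reads exactly one letter, so paths can be
  followed by recursion on the word instead of on a list of edges; \<open>m\<close> collects the
  monoid label.\<close>

primrec run ::
    "('m, 'b) monoid_scheme \<Rightarrow> ('q, 'm \<times> 'x list) automaton \<Rightarrow> 'q \<Rightarrow> 'x list \<Rightarrow> 'm \<Rightarrow> 'q \<Rightarrow> bool" where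
  "run M A p [] m q \<longleftrightarrow> p \<in> states A \<and> q = p \<and> m = \<one>\<^bsub>M\<^esub>"
| "run M A p (x # w) m q \<longleftrightarrow>
     (\<exists>g r m'. (p, (g, [x]), r) \<in> edges A \<and> run M A r w m' q \<and> m = g \<otimes>\<^bsub>M\<^esub> m')"

locale det_automaton = monoid M for M :: "('m, 'b) monoid_scheme" (structure) +
  fixes X :: "'x set" and A :: "('q, 'm \<times> 'x list) automaton"
  assumes M_automaton: "M_automaton M X A" and deterministic: "deterministic M X A"
begin

lemma finite_states: "finite (states A)"
  and init: "init A \<in> states A"
  using M_automaton by (auto simp: M_automaton_def finite_automaton_over_def)

lemma edgeE:
  assumes "(p, n, q) \<in> edges A"
  obtains g x where "n = (g, [x])" "g \<in> carrier M" "x \<in> X" "p \<in> states A" "q \<in> states A"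
proof -
  have "p \<in> states A" "q \<in> states A"
    using assms M_automaton by (auto simp: M_automaton_def finite_automaton_over_def)
  moreover obtain g x where "g \<in> carrier M" "x \<in> X" "n = (g, [x])"
    using assms deterministic unfolding deterministic_def by blast
  ultimately show thesis
    using that by blast
qed

lemma edge_unique:
  assumes "(p, (g, [x]), q) \<in> edges A" and "(p, (g', [x]), q') \<in> edges A"
  shows "g = g'" and "q = q'"
proof -
  have "p \<in> states A" "x \<in> X"
    using edgeE[OF assms(1)] by auto
  then have "g = g' \<and> q = q'"
    using assms deterministic unfolding deterministic_def by blast
  then show "g = g'" "q = q'"
    by auto
qed

lemma run_closed:
  assumes "run M A p w m q"
  shows "m \<in> carrier M" "p \<in> states A" "q \<in> states A" "w \<in> lists X"
proof -
  have "m \<in> carrier M \<and> p \<in> states A \<and> q \<in> states A \<and> w \<in> lists X"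
    using assms by (induction w arbitrary: p m) (auto elim!: edgeE)
  then show "m \<in> carrier M" "p \<in> states A" "q \<in> states A" "w \<in> lists X"
    by auto
qed

lemma run_unique:
  assumes "run M A p w m q" and "run M A p w m' q'"
  shows "m = m'" and "q = q'"
proof -
  have "m = m' \<and> q = q'"
    using assms
  proof (induction w arbitrary: p m m')
    case (Cons x w)
    then obtain g r n g' r' n' where
      "(p, (g, [x]), r) \<in> edges A" "run M A r w n q" "m = g \<otimes> n"
      "(p, (g', [x]), r') \<in> edges A" "run M A r' w n' q'" "m' = g' \<otimes> n'"
      by auto
    then show ?case
      using Cons.IH edge_unique by metis
  qed simp
  then show "m = m'" "q = q'"
    by auto
qed

lemma run_append:
  "run M A p (v @ w) m q \<longleftrightarrow> (\<exists>r m1 m2. run M A p v m1 r \<and> run M A r w m2 q \<and> m = m1 \<otimes> m2)"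
proof (induction v arbitrary: p m)
  case Nil
  then show ?case
    using run_closed by fastforce
next
  case (Cons x v)
  show ?case (is "?L \<longleftrightarrow> ?R")
  proof
    assume ?L
    then obtain g r s m1 m2 where "(p, (g, [x]), r) \<in> edges A" "run M A r v m1 s"
      "run M A s w m2 q" "m = g \<otimes> (m1 \<otimes> m2)"
      using Cons.IH by auto
    moreover from this have "m = (g \<otimes> m1) \<otimes> m2"
      using run_closed(1) by (auto elim!: edgeE simp: m_assoc)
    ultimately show ?R
      by (intro exI[of _ s] exI[of _ "g \<otimes> m1"] exI[of _ m2]) auto
  next
    assume ?R
    then obtain g r s m1 m2 where "(p, (g, [x]), r) \<in> edges A" "run M A r v m1 s"
      "run M A s w m2 q" "m = (g \<otimes> m1) \<otimes> m2"
      by auto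
    moreover from this have "m = g \<otimes> (m1 \<otimes> m2)"
      using run_closed(1) by (auto elim!: edgeE simp: m_assoc)
    moreover have "run M A r (v @ w) (m1 \<otimes> m2) q"
      using Cons.IH calculation by blast
    ultimately show ?L
      unfolding append_Cons run.simps by blast
  qed
qed

text \<open>Since every edge consumes a letter, the edges of a path match the letters of its word
  one by one; in particular only the empty path reads the empty word.\<close>

lemma run_iff_path:
  "run M A p w m q \<longleftrightarrow>
     (\<exists>es. is_path A p es q \<and> path_label (M \<times>\<times> free_monoid X) es = (m, w))"
proof
  assume "run M A p w m q"
  then show "\<exists>es. is_path A p es q \<and> path_label (M \<times>\<times> free_monoid X) es = (m, w)"
  proof (induction w arbitrary: p m)
    case Nil
    then show ?case
      by (intro exI[of _ "[]"]) (simp add: path_label_def DirProd_def free_monoid_def)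
  next
    case (Cons x w)
    then obtain g r n where e: "(p, (g, [x]), r) \<in> edges A" "run M A r w n q" "m = g \<otimes> n"
      by auto
    then obtain es where "is_path A r es q" "path_label (M \<times>\<times> free_monoid X) es = (n, w)"
      using Cons.IH by blast
    then show ?case
      using e by (intro exI[of _ "(p, (g, [x]), r) # es"])
        (simp add: path_label_def DirProd_def free_monoid_def)
  qed
next
  assume "\<exists>es. is_path A p es q \<and> path_label (M \<times>\<times> free_monoid X) es = (m, w)"
  then obtain es where "is_path A p es q" "path_label (M \<times>\<times> free_monoid X) es = (m, w)"
    by blast
  then show "run M A p w m q"
  proof (induction es arbitrary: p m w)
    case Nil
    then show ?case
      by (simp add: path_label_def DirProd_def free_monoid_def)
  next
    case (Cons e es)
    obtain n r where e: "e = (p, n, r)" "(p, n, r) \<in> edges A" and es: "is_path A r es q"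
      using Cons.prems(1) by (cases e) auto
    obtain g x where n: "n = (g, [x])"
      using e(2) by (rule edgeE)
    obtain m' w' where l: "path_label (M \<times>\<times> free_monoid X) es = (m', w')"
      by fastforce
    then have "m = g \<otimes> m'" "w = x # w'"
      using Cons.prems(2) e(1) n
      by (auto simp: path_label_def DirProd_def free_monoid_def)
    then show ?case
      using Cons.IH[OF es l] e(2) n by auto
  qed
qed

lemma accepted_language_eq:
  "accepted_language M X A = {w. \<exists>t\<in>terminals A. run M A (init A) w \<one> t}"
  unfolding accepted_language_def accepts_def run_iff_path[symmetric] using run_closed(4) by blast

end

section \<open>From automata to subgroups\<close>

locale word_problem_automaton = det_automaton M X A + H: group H
  for M :: "('m, 'b) monoid_scheme" (structure)
    and H :: "('h, 'c) monoid_scheme" (structure)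
    and X and A :: "('q, 'm \<times> 'h list) automaton" +
  assumes unique_left_inverses: "unique_left_inverses M"
    and generates: "generates_as_monoid H X"
    and accepted: "accepted_language M X A = word_problem H X"
begin

abbreviation val :: "'h list \<Rightarrow> 'h" where
  "val w \<equiv> list_product H w"

lemma lists_X [simp]: "w \<in> lists X \<Longrightarrow> w \<in> lists (carrier H)"
  using generates by (auto simp: generates_as_monoid_def)

lemma val_append: "\<lbrakk>v \<in> lists X; w \<in> lists X\<rbrakk> \<Longrightarrow> val (v @ w) = val v \<otimes>\<^bsub>H\<^esub> val w"
  by (simp add: H.list_product_append)

lemma obtain_word:
  assumes "h \<in> carrier H"
  obtains w where "w \<in> lists X" "val w = h"
  using assms generates unfolding generates_as_monoid_def by blast

lemma val_one_iff:
  assumes "w \<in> lists X"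
  shows "val w = \<one>\<^bsub>H\<^esub> \<longleftrightarrow> (\<exists>t\<in>terminals A. run M A (init A) w \<one>\<^bsub>M\<^esub> t)"
proof -
  have "val w = \<one>\<^bsub>H\<^esub> \<longleftrightarrow> w \<in> accepted_language M X A"
    using assms accepted by (simp add: word_problem_def)
  then show ?thesis
    by (simp add: accepted_language_eq)
qed

text \<open>Completing \<open>u @ w\<close> by a word for the inverse of its value gives an accepted
  word. Its run must pass through \<open>p\<close> after \<open>u\<close> by uniqueness of runs, so
  \<open>w\<close> can be read from \<open>p\<close>.\<close>

lemma run_total:
  assumes u: "run M A (init A) u m p" and w: "w \<in> lists X"
  obtains n q where "run M A p w n q"
proof -
  have uX: "u \<in> lists X"
    using u by (rule run_closed)
  obtain z where z: "z \<in> lists X" "val z = inv\<^bsub>H\<^esub> (val (u @ w))"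
    using obtain_word[of "inv\<^bsub>H\<^esub> (val (u @ w))"] uX w by auto
  then have "val ((u @ w) @ z) = \<one>\<^bsub>H\<^esub>"
    using uX w by (subst val_append) auto
  then obtain t where "run M A (init A) ((u @ w) @ z) \<one>\<^bsub>M\<^esub> t"
    using val_one_iff[of "(u @ w) @ z"] uX w z by auto
  then show thesis
    using run_unique(2)[OF u] that unfolding run_append by metis
qed

text \<open>A maximal state \<open>s\<close> for reachability is recurrent, but the label and the
  value of a word leading there are arbitrary. Continuing by a word \<open>z\<close> for the inverse
  of that value reaches a terminal state \<open>p\<close> with label and value both trivial, and
  \<open>p\<close> inherits recurrence because it is reachable from \<open>s\<close>.\<close>

lemma obtain_recurrent:
  obtains u p where "run M A (init A) u \<one>\<^bsub>M\<^esub> p" "val u = \<one>\<^bsub>H\<^esub>"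
    "\<And>w m q. run M A p w m q \<Longrightarrow> \<exists>v n. run M A q v n p"
proof -
  define reach where "reach p q \<longleftrightarrow> (\<exists>w m. run M A p w m q)" for p q
  have trans: "reach p r" if "reach p q" "reach q r" for p q r
    using that unfolding reach_def by (metis run_append)
  define P where "P = {p. reach (init A) p}"
  have "P \<subseteq> states A"
    using run_closed(3) by (auto simp: P_def reach_def)
  then have "finite P"
    using finite_states finite_subset by blast
  have "init A \<in> P"
    unfolding P_def reach_def using init by (auto intro: exI[of _ "[]"])
  then have "P \<noteq> {}"
    by blast
  then have "\<exists>s\<in>P. \<forall>q\<in>P. reach s q \<longrightarrow> reach q s"
    using \<open>finite P\<close> trans by (intro finite_preorder_has_maximal) blast+
  then obtain s where s: "s \<in> P" and max: "\<And>q. \<lbrakk>q \<in> P; reach s q\<rbrakk> \<Longrightarrow> reach q s"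
    by blast
  obtain v n where v: "run M A (init A) v n s"
    using s by (auto simp: P_def reach_def)
  have vX: "v \<in> lists X"
    using v by (rule run_closed)
  obtain z where z: "z \<in> lists X" "val z = inv\<^bsub>H\<^esub> (val v)"
    using obtain_word[of "inv\<^bsub>H\<^esub> (val v)"] vX by auto
  then have one: "val (v @ z) = \<one>\<^bsub>H\<^esub>"
    using vX by (simp add: val_append)
  then obtain p where p: "run M A (init A) (v @ z) \<one>\<^bsub>M\<^esub> p"
    using val_one_iff[of "v @ z"] vX z by auto
  then have "reach s p"
    using run_unique(2)[OF v] unfolding run_append reach_def by metis
  have "\<exists>v n. run M A q v n p" if "run M A p w m q" for w m q
  proof -
    have "reach p q"
      using that by (auto simp: reach_def)
    then have "reach q s"
      using max[of q] trans \<open>reach s p\<close> s unfolding P_def by blast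
    then show ?thesis
      using trans[OF _ \<open>reach s p\<close>] by (auto simp: reach_def)
  qed
  then show thesis
    using that one p by blast
qed

text \<open>One word \<open>z\<close> for the inverse of \<open>val v\<close> tests both words: from
  \<open>p\<close> it has a single label \<open>k\<close>, with \<open>m \<otimes> k\<close> equal
  to the identity. Equality of values means that \<open>w @ z\<close> is accepted, that is, that
  \<open>n\<close> is a left inverse of \<open>k\<close> as well; uniqueness of left inverses makes
  this \<open>m = n\<close>.\<close>

lemma label_eq_iff:
  assumes v: "run M A (init A) v m p" and w: "run M A (init A) w n p"
  shows "m = n \<longleftrightarrow> val v = val w"
proof -
  have X: "v \<in> lists X" "w \<in> lists X"
    using v w run_closed(4) by auto
  obtain z where z: "z \<in> lists X" "val z = inv\<^bsub>H\<^esub> (val v)"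
    using obtain_word[of "inv\<^bsub>H\<^esub> (val v)"] X by auto
  then have "val (v @ z) = \<one>\<^bsub>H\<^esub>"
    using X by (simp add: val_append)
  then obtain t where t: "t \<in> terminals A" "run M A (init A) (v @ z) \<one>\<^bsub>M\<^esub> t"
    using val_one_iff[of "v @ z"] X z by auto
  then obtain k where k: "run M A p z k t" "m \<otimes> k = \<one>\<^bsub>M\<^esub>"
    using run_unique[OF v] unfolding run_append by metis
  have wz: "run M A (init A) (w @ z) (n \<otimes> k) t"
    using w k(1) run_append by blast
  have "val v = val w \<longleftrightarrow> val (w @ z) = \<one>\<^bsub>H\<^esub>"
  proof -
    have "val (w @ z) = val w \<otimes>\<^bsub>H\<^esub> inv\<^bsub>H\<^esub> val v"
      using X z by (simp add: val_append)
    also have "\<dots> = \<one>\<^bsub>H\<^esub> \<longleftrightarrow> val w = val v"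
      using X by (metis H.inv_equality H.inv_inv H.inv_closed H.list_product_closed H.r_inv lists_X)
    finally show ?thesis
      by auto
  qed
  also have "\<dots> \<longleftrightarrow> (\<exists>s\<in>terminals A. run M A (init A) (w @ z) \<one>\<^bsub>M\<^esub> s)"
    using X z by (intro val_one_iff) simp
  \<comment> \<open>The run \<open>wz\<close> is the only one on \<open>w @ z\<close> and it ends in
    the terminal state \<open>t\<close>, so acceptance depends on its label alone.\<close>
  also have "\<dots> \<longleftrightarrow> n \<otimes> k = \<one>\<^bsub>M\<^esub>"
    using wz t(1) run_unique(1)[OF wz] by metis
  also have "\<dots> \<longleftrightarrow> m = n"
    using unique_left_inverses k run_closed(1)[OF v] run_closed(1)[OF w] run_closed(1)[OF k(1)]
    unfolding unique_left_inverses_def by blast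
  finally show ?thesis
    by blast
qed

theorem finite_index_subgroup:
  "\<exists>K. subgroup K H \<and> finite (rcosets\<^bsub>H\<^esub> K) \<and> (\<exists>f. f \<in> mon (H\<lparr>carrier := K\<rparr>) (units_of M))"
proof -
  obtain u p where u: "run M A (init A) u \<one>\<^bsub>M\<^esub> p" "val u = \<one>\<^bsub>H\<^esub>"
    and rec: "\<And>w m q. run M A p w m q \<Longrightarrow> \<exists>v n. run M A q v n p"
    using obtain_recurrent by metis
  have uX: "u \<in> lists X"
    using u(1) by (rule run_closed)
  \<comment> \<open>The prefix \<open>u\<close> changes neither label nor value, so
    \<open>label_eq_iff\<close>, which concerns runs from the initial state, applies to loops at
    \<open>p\<close>.\<close>
  have from_init: "run M A (init A) (u @ w) m p" if "run M A p w m p" for w m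
    using u(1) that run_closed(1)[OF that] unfolding run_append by force
  define K where "K = {val w |w. \<exists>m. run M A p w m p}"
  have KI: "val w \<in> K" if "run M A p w m p" for w m
    using that by (auto simp: K_def)
  have K: "K \<subseteq> carrier H"
    using run_closed(4) by (auto simp: K_def)
  have one: "\<one>\<^bsub>H\<^esub> \<in> K"
    using KI[of "[]" "\<one>\<^bsub>M\<^esub>"] run_closed(3)[OF u(1)] by simp
  have mult: "a \<otimes>\<^bsub>H\<^esub> b \<in> K" if ab: "a \<in> K" "b \<in> K" for a b
  proof -
    obtain v w m n where "a = val v" "run M A p v m p" "b = val w" "run M A p w n p"
      using ab unfolding K_def by blast
    then show ?thesis
      using KI[of "v @ w" "m \<otimes> n"] run_append run_closed(4) val_append by metis
  qed
  \<comment> \<open>Each state of \<open>P\<close> gets a fixed word \<open>ret q\<close> back to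
    \<open>p\<close>. If \<open>w\<close> leads from \<open>p\<close> to \<open>q\<close>, then
    \<open>w @ ret q\<close> is a loop, so \<open>val w\<close> lies in the translate of
    \<open>K\<close> by the inverse of \<open>val (ret q)\<close>; finitely many states give
    finitely many translates.\<close>
  define P where "P = {q \<in> states A. \<exists>v n. run M A q v n p}"
  define ret where "ret q = (SOME v. \<exists>n. run M A q v n p)" for q
  have ret: "\<exists>n. run M A q (ret q) n p" if "q \<in> P" for q
    unfolding ret_def using that by (intro someI_ex[of "\<lambda>v. \<exists>n. run M A q v n p"]) (simp add: P_def)
  then have retX: "ret q \<in> lists X" if "q \<in> P" for q
    using that run_closed(4) by blast
  let ?R = "(\<lambda>q. inv\<^bsub>H\<^esub> (val (ret q))) ` P"
  have "finite ?R" "?R \<subseteq> carrier H"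
    using finite_states H.list_product_closed[OF lists_X[OF retX]] by (auto simp: P_def)
  moreover have "carrier H \<subseteq> (\<Union>r\<in>?R. K #>\<^bsub>H\<^esub> r)"
  proof
    fix h
    assume h: "h \<in> carrier H"
    then obtain w where w: "w \<in> lists X" "val w = h"
      by (rule obtain_word)
    obtain m q where q: "run M A p w m q"
      using run_total[OF u(1) w(1)] .
    then have P: "q \<in> P"
      using rec run_closed(3) by (auto simp: P_def)
    then obtain n where "run M A q (ret q) n p"
      using ret by blast
    then have "val (w @ ret q) \<in> K"
      using q run_append KI by metis
    moreover have "h = val (w @ ret q) \<otimes>\<^bsub>H\<^esub> inv\<^bsub>H\<^esub> val (ret q)"
      using w h retX[OF P] by (simp add: val_append H.m_assoc)
    ultimately show "h \<in> (\<Union>r\<in>?R. K #>\<^bsub>H\<^esub> r)"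
      using P unfolding r_coset_def by blast
  qed
  ultimately have sub: "subgroup K H" and fin: "finite (rcosets\<^bsub>H\<^esub> K)"
    using H.submonoid_finite_cover[OF K one mult, of ?R] by auto
  have label: "m = n \<longleftrightarrow> val v = val w" if "run M A p v m p" "run M A p w n p" for v w m n
    using label_eq_iff[OF from_init[OF that(1)] from_init[OF that(2)]] uX u(2) run_closed(4) that
    by (simp add: val_append)
  \<comment> \<open>The description is unique by \<open>label\<close>: all loops at \<open>p\<close>
    with value \<open>h\<close> carry the same label.\<close>
  define f where "f h = (THE m. \<exists>w. val w = h \<and> run M A p w m p)" for h
  have f: "f (val w) = m" if "run M A p w m p" for w m
    unfolding f_def using that label by (intro the_equality) blast+
  have f_mult: "f (a \<otimes>\<^bsub>H\<^esub> b) = f a \<otimes> f b" if ab: "a \<in> K" "b \<in> K" for a b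
  proof -
    obtain v w m n where *: "a = val v" "run M A p v m p" "b = val w" "run M A p w n p"
      using ab unfolding K_def by blast
    then have "run M A p (v @ w) (m \<otimes> n) p"
      using run_append by blast
    then show ?thesis
      using f * run_closed(4) val_append by metis
  qed
  have f_one: "f \<one>\<^bsub>H\<^esub> = \<one>\<^bsub>M\<^esub>"
    using f[of "[]" "\<one>\<^bsub>M\<^esub>"] run_closed(3)[OF u(1)] by simp
  have f_carrier: "f a \<in> carrier M" if "a \<in> K" for a
    using that f run_closed(1) by (auto simp: K_def)
  \<comment> \<open>Here it matters that \<open>K\<close> is a subgroup and not just a submonoid:
    the inverse of \<open>a\<close> is again the value of a loop, whose label inverts
    \<open>f a\<close> on both sides.\<close>
  have f_unit: "f a \<in> Units M" if "a \<in> K" for a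
  proof -
    have a: "inv\<^bsub>H\<^esub> a \<in> K" "a \<in> carrier H"
      using that sub K by (auto intro: subgroup.m_inv_closed)
    then have "f (inv\<^bsub>H\<^esub> a) \<otimes> f a = \<one>\<^bsub>M\<^esub>" "f a \<otimes> f (inv\<^bsub>H\<^esub> a) = \<one>\<^bsub>M\<^esub>"
      using f_mult[of "inv\<^bsub>H\<^esub> a" a] f_mult[of a "inv\<^bsub>H\<^esub> a"] that f_one by auto
    then show ?thesis
      using f_carrier a that unfolding Units_def by blast
  qed
  have "inj_on f K"
  proof (rule inj_onI)
    fix a b
    assume "a \<in> K" "b \<in> K" "f a = f b"
    then show "a = b"
      using f label by (auto simp: K_def)
  qed
  then have "f \<in> mon (H\<lparr>carrier := K\<rparr>) (units_of M)"
    using f_mult f_unit by (auto simp: mon_def hom_def units_of_def)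
  then show ?thesis
    using sub fin by blast
qed

end

section \<open>From subgroups to automata\<close>

text \<open>A word of value \<open>h\<close> returns from the initial coset to itself exactly when
  \<open>h\<close> lies in \<open>K\<close>, and then its label is \<open>f h\<close>. Injectivity
  of \<open>f\<close> leaves only the words of value one.\<close>

theorem schreier_automaton:
  fixes M :: "('m, 'b) monoid_scheme" (structure)
    and H :: "('h, 'c) monoid_scheme" (structure)
  assumes "monoid M" and "group H" and "finite X" and X: "X \<subseteq> carrier H"
    and sub: "subgroup K H" and fin: "finite (rcosets\<^bsub>H\<^esub> K)"
    and f: "f \<in> mon (H\<lparr>carrier := K\<rparr>) (units_of M)"
  shows "\<exists>A :: (nat, 'm \<times> 'h list) automaton.
    M_automaton M X A \<and> deterministic M X A \<and> accepted_language M X A = word_problem H X"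
proof -
  interpret M: monoid M by fact
  interpret H: group H by fact
  interpret K: subgroup K H by fact
  have f_unit: "f a \<in> Units M" and f_carrier: "f a \<in> carrier M" if "a \<in> K" for a
    using f that by (auto simp: mon_def hom_def units_of_def)
  have f_mult: "f (a \<otimes>\<^bsub>H\<^esub> b) = f a \<otimes>\<^bsub>M\<^esub> f b" if "a \<in> K" "b \<in> K" for a b
    using f that by (auto simp: mon_def hom_def units_of_def)
  have inj: "inj_on f K"
    using f by (simp add: mon_def)
  have f_one: "f \<one>\<^bsub>H\<^esub> = \<one>\<^bsub>M\<^esub>"
  proof -
    \<comment> \<open>The image of the identity is idempotent, and as a unit it can be
      cancelled.\<close>
    have "f \<one>\<^bsub>H\<^esub> \<otimes>\<^bsub>M\<^esub> f \<one>\<^bsub>H\<^esub> = f \<one>\<^bsub>H\<^esub> \<otimes>\<^bsub>M\<^esub> \<one>\<^bsub>M\<^esub>"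
      using f_mult[of "\<one>\<^bsub>H\<^esub>" "\<one>\<^bsub>H\<^esub>"] f_carrier[of "\<one>\<^bsub>H\<^esub>"] by simp
    then show ?thesis
      using f_unit[of "\<one>\<^bsub>H\<^esub>"] f_carrier[of "\<one>\<^bsub>H\<^esub>"] by (subst (asm) M.Units_l_cancel) auto
  qed
  \<comment> \<open>Cosets are numbered because the states are to be natural numbers.\<close>
  obtain enc :: "'h set \<Rightarrow> nat" where enc: "inj_on enc (rcosets\<^bsub>H\<^esub> K)"
    using finite_imp_inj_to_nat_seg[OF fin] by blast
  have cosetI: "K #>\<^bsub>H\<^esub> h \<in> rcosets\<^bsub>H\<^esub> K" if "h \<in> carrier H" for h
    using that by (auto simp: RCOSETS_def)
  define c where "c h = enc (K #>\<^bsub>H\<^esub> h)" for h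
  have c_eq: "c g = c h \<longleftrightarrow> K #>\<^bsub>H\<^esub> g = K #>\<^bsub>H\<^esub> h" if "g \<in> carrier H" "h \<in> carrier H" for g h
    unfolding c_def using inj_on_eq_iff[OF enc cosetI cosetI] that by blast
  \<comment> \<open>The coset \<open>K\<close> itself is represented by the identity, so that the
    label of a word leading from the initial state back to it is \<open>f\<close> of its value, with
    no correction by a representative.\<close>
  define r where "r i = (if i = c \<one>\<^bsub>H\<^esub> then \<one>\<^bsub>H\<^esub> else SOME h. h \<in> carrier H \<and> c h = i)" for i
  define S where "S = c ` carrier H"
  have r: "r i \<in> carrier H" "c (r i) = i" if "i \<in> S" for i
  proof -
    have "\<exists>h. h \<in> carrier H \<and> c h = i"
      using that by (auto simp: S_def)
    then have "r i \<in> carrier H \<and> c (r i) = i"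
      unfolding r_def using someI_ex[of "\<lambda>h. h \<in> carrier H \<and> c h = i"] by auto
    then show "r i \<in> carrier H" "c (r i) = i"
      by auto
  qed
  have SI: "c h \<in> S" if "h \<in> carrier H" for h
    using that by (simp add: S_def)
  have "S \<subseteq> enc ` (rcosets\<^bsub>H\<^esub> K)"
    using cosetI by (auto simp: S_def c_def)
  then have finS: "finite S"
    by (rule finite_surj[OF fin])
  \<comment> \<open>The second argument ranges over group elements and not only generators, so that
    the same formula describes the label of a whole word through its value.\<close>
  define lab where "lab i h = f (r i \<otimes>\<^bsub>H\<^esub> h \<otimes>\<^bsub>H\<^esub> inv\<^bsub>H\<^esub> (r (c (r i \<otimes>\<^bsub>H\<^esub> h))))" for i h
  \<comment> \<open>An element and the representative of its right coset differ by a left factor in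
    \<open>K\<close>; this keeps every argument of \<open>f\<close> in its domain.\<close>
  have in_K: "h \<otimes>\<^bsub>H\<^esub> inv\<^bsub>H\<^esub> (r (c h)) \<in> K" if h: "h \<in> carrier H" for h
  proof -
    have "K #>\<^bsub>H\<^esub> h = K #>\<^bsub>H\<^esub> r (c h)"
      using c_eq[of "r (c h)" h] r[OF SI[OF h]] h by simp
    then have "h \<in> K #>\<^bsub>H\<^esub> r (c h)"
      using H.rcos_self[OF h sub] by simp
    then obtain k where "k \<in> K" "h = k \<otimes>\<^bsub>H\<^esub> r (c h)"
      by (auto simp: r_coset_def)
    then show ?thesis
      using r[OF SI[OF h]] h by (metis H.inv_solve_right K.mem_carrier)
  qed
  have c_mult: "c (r (c g) \<otimes>\<^bsub>H\<^esub> h) = c (g \<otimes>\<^bsub>H\<^esub> h)" if "g \<in> carrier H" "h \<in> carrier H" for g h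
  proof -
    have "K #>\<^bsub>H\<^esub> r (c g) = K #>\<^bsub>H\<^esub> g"
      using c_eq[of "r (c g)" g] r[OF SI[OF that(1)]] that by simp
    then have "K #>\<^bsub>H\<^esub> (r (c g) \<otimes>\<^bsub>H\<^esub> h) = K #>\<^bsub>H\<^esub> (g \<otimes>\<^bsub>H\<^esub> h)"
      using that r[OF SI[OF that(1)]] H.coset_mult_assoc[OF K.subset] by metis
    then show ?thesis
      by (simp add: c_def)
  qed
  define A :: "(nat, 'm \<times> 'h list) automaton" where
    "A = \<lparr>states = S, init = c \<one>\<^bsub>H\<^esub>, terminals = {c \<one>\<^bsub>H\<^esub>},
          edges = (\<lambda>(i, x). (i, (lab i x, [x]), c (r i \<otimes>\<^bsub>H\<^esub> x))) ` (S \<times> X)\<rparr>"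
  have A [simp]: "states A = S" "init A = c \<one>\<^bsub>H\<^esub>" "terminals A = {c \<one>\<^bsub>H\<^esub>}"
    by (auto simp: A_def)
  have edges [simp]: "(i, (g, w), j) \<in> edges A \<longleftrightarrow>
      i \<in> S \<and> (\<exists>x\<in>X. w = [x] \<and> g = lab i x \<and> j = c (r i \<otimes>\<^bsub>H\<^esub> x))" for i g w j
    by (auto simp: A_def)
  have lab_closed: "lab i h \<in> carrier M" if "i \<in> S" "h \<in> carrier H" for i h
    unfolding lab_def using that r in_K f_carrier by simp
  have aut: "M_automaton M X A"
    unfolding M_automaton_def finite_automaton_over_def
    using finS \<open>finite X\<close> X SI lab_closed r
    by (auto simp: A_def DirProd_def free_monoid_def)
  have det: "deterministic M X A"
    unfolding deterministic_def using lab_closed subsetD[OF X] by auto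
  interpret det_automaton M X A
    using aut det by unfold_locales
  have X': "w \<in> lists (carrier H)" if "w \<in> lists X" for w
    using that X by auto
  text \<open>The labels along a path telescope.\<close>
  have run: "run M A i w m j \<longleftrightarrow> i \<in> S \<and> j = c (r i \<otimes>\<^bsub>H\<^esub> list_product H w) \<and> m = lab i (list_product H w)"
    if "w \<in> lists X" for i w m j
    using that
  proof (induction w arbitrary: i m)
    case Nil
    have "lab i \<one>\<^bsub>H\<^esub> = \<one>\<^bsub>M\<^esub>" "c (r i \<otimes>\<^bsub>H\<^esub> \<one>\<^bsub>H\<^esub>) = i" if "i \<in> S"
      using r[OF that] f_one by (auto simp: lab_def)
    then show ?case
      by auto
  next
    case (Cons x w)
    then have x: "x \<in> X" "x \<in> carrier H" and w: "w \<in> lists X" "list_product H w \<in> carrier H"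
      using X X' by auto
    show ?case (is "_ \<longleftrightarrow> ?R")
    proof (cases "i \<in> S")
      case True
      define h where "h = list_product H w"
      define i' where "i' = c (r i \<otimes>\<^bsub>H\<^esub> x)"
      have h: "h \<in> carrier H" and ri: "r i \<in> carrier H"
        using w r True by (auto simp: h_def)
      have i': "i' \<in> S" and ri': "r i' \<in> carrier H"
        using SI r ri x by (auto simp: i'_def)
      have c': "c (r i' \<otimes>\<^bsub>H\<^esub> h) = c (r i \<otimes>\<^bsub>H\<^esub> (x \<otimes>\<^bsub>H\<^esub> h))"
        using c_mult[of "r i \<otimes>\<^bsub>H\<^esub> x" h] ri x h by (simp add: i'_def H.m_assoc)
      define s where "s = r (c (r i \<otimes>\<^bsub>H\<^esub> (x \<otimes>\<^bsub>H\<^esub> h)))"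
      have s: "s \<in> carrier H"
        using r SI ri x h by (simp add: s_def)
      \<comment> \<open>With both factors in \<open>K\<close>, \<open>f\<close> is multiplicative on
        their product, in which \<open>r i'\<close> cancels against its inverse.\<close>
      have K1: "r i \<otimes>\<^bsub>H\<^esub> x \<otimes>\<^bsub>H\<^esub> inv\<^bsub>H\<^esub> (r i') \<in> K"
        using in_K[of "r i \<otimes>\<^bsub>H\<^esub> x"] ri x by (simp add: i'_def)
      have K2: "r i' \<otimes>\<^bsub>H\<^esub> h \<otimes>\<^bsub>H\<^esub> inv\<^bsub>H\<^esub> s \<in> K"
        using in_K[of "r i' \<otimes>\<^bsub>H\<^esub> h"] ri' h c' by (simp add: s_def)
      have "inv\<^bsub>H\<^esub> (r i') \<otimes>\<^bsub>H\<^esub> (r i' \<otimes>\<^bsub>H\<^esub> (h \<otimes>\<^bsub>H\<^esub> inv\<^bsub>H\<^esub> s)) = h \<otimes>\<^bsub>H\<^esub> inv\<^bsub>H\<^esub> s"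
        using ri' h s by (simp add: H.m_assoc[symmetric])
      then have "(r i \<otimes>\<^bsub>H\<^esub> x \<otimes>\<^bsub>H\<^esub> inv\<^bsub>H\<^esub> (r i')) \<otimes>\<^bsub>H\<^esub> (r i' \<otimes>\<^bsub>H\<^esub> h \<otimes>\<^bsub>H\<^esub> inv\<^bsub>H\<^esub> s)
          = r i \<otimes>\<^bsub>H\<^esub> (x \<otimes>\<^bsub>H\<^esub> h) \<otimes>\<^bsub>H\<^esub> inv\<^bsub>H\<^esub> s"
        using ri ri' x h s by (simp add: H.m_assoc)
      then have lab: "lab i x \<otimes>\<^bsub>M\<^esub> lab i' h = lab i (x \<otimes>\<^bsub>H\<^esub> h)"
        using f_mult[OF K1 K2] by (simp add: lab_def c' i'_def[symmetric] s_def[symmetric])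
      have "run M A i (x # w) m j \<longleftrightarrow> (\<exists>m'. run M A i' w m' j \<and> m = lab i x \<otimes>\<^bsub>M\<^esub> m')"
        using True x by (auto simp: i'_def)
      also have "\<dots> \<longleftrightarrow> ?R"
        using Cons.IH i' c' lab True by (auto simp: h_def)
      finally show ?thesis .
    qed auto
  qed
  have "w \<in> accepted_language M X A \<longleftrightarrow> w \<in> word_problem H X" for w
  proof (cases "w \<in> lists X")
    case True
    define h where "h = list_product H w"
    have h: "h \<in> carrier H"
      using True X' by (auto simp: h_def)
    have r1: "r (c \<one>\<^bsub>H\<^esub>) = \<one>\<^bsub>H\<^esub>"
      by (simp add: r_def)
    have "w \<in> accepted_language M X A \<longleftrightarrow> c h = c \<one>\<^bsub>H\<^esub> \<and> lab (c \<one>\<^bsub>H\<^esub>) h = \<one>\<^bsub>M\<^esub>"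
      using run[OF True] h SI by (auto simp: accepted_language_eq h_def[symmetric] r1)
    also have "\<dots> \<longleftrightarrow> c h = c \<one>\<^bsub>H\<^esub> \<and> f h = f \<one>\<^bsub>H\<^esub>"
      using h by (auto simp: lab_def r1 f_one)
    \<comment> \<open>Injectivity holds only on \<open>K\<close>; equality of the cosets puts
      \<open>h\<close> there, by \<open>in_K\<close> with the trivial representative
      \<open>r1\<close>.\<close>
    also have "\<dots> \<longleftrightarrow> h = \<one>\<^bsub>H\<^esub>"
      using inj_onD[OF inj, of h "\<one>\<^bsub>H\<^esub>"] in_K[OF h] h by (auto simp: r1)
    finally show ?thesis
      using True by (simp add: word_problem_def h_def)
  qed (auto simp: accepted_language_def word_problem_def)
  then show ?thesis
    using aut det by blast
qed

text \<open>Taking states in \<open>nat\<close> loses no generality, since finitely many states can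
  be renumbered; the passage from automata to subgroups is carried out for an arbitrary state
  type.\<close>

theorem theorem1:
  fixes M :: "('m, 'b) monoid_scheme"
    and H :: "('h, 'c) monoid_scheme"
    and X :: "'h set"
  assumes "monoid M"
    and "unique_left_inverses M"
    and "group H"
    and "finite X"
    and "generates_as_monoid H X"
  shows "(\<exists>A :: (nat, 'm \<times> 'h list) automaton.
            M_automaton M X A \<and> deterministic M X A \<and>
            accepted_language M X A = word_problem H X)
     \<longleftrightarrow> (\<exists>K. subgroup K H \<and> finite (rcosets\<^bsub>H\<^esub> K) \<and>
            (\<exists>f. f \<in> mon (H\<lparr>carrier := K\<rparr>) (units_of M)))"
proof
  assume "\<exists>A :: (nat, 'm \<times> 'h list) automaton.
            M_automaton M X A \<and> deterministic M X A \<and> accepted_language M X A = word_problem H X"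
  then obtain A :: "(nat, 'm \<times> 'h list) automaton" where
    "M_automaton M X A" "deterministic M X A" "accepted_language M X A = word_problem H X"
    by blast
  then have "word_problem_automaton M H X A"
    using assms by (intro word_problem_automaton.intro det_automaton.intro
      det_automaton_axioms.intro word_problem_automaton_axioms.intro)
  then show "\<exists>K. subgroup K H \<and> finite (rcosets\<^bsub>H\<^esub> K) \<and>
            (\<exists>f. f \<in> mon (H\<lparr>carrier := K\<rparr>) (units_of M))"
    by (rule word_problem_automaton.finite_index_subgroup)
next
  assume "\<exists>K. subgroup K H \<and> finite (rcosets\<^bsub>H\<^esub> K) \<and>
            (\<exists>f. f \<in> mon (H\<lparr>carrier := K\<rparr>) (units_of M))"
  then show "\<exists>A :: (nat, 'm \<times> 'h list) automaton.
            M_automaton M X A \<and> deterministic M X A \<and> accepted_language M X A = word_problem H X"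
    using schreier_automaton[OF assms(1,3,4)] assms(5) unfolding generates_as_monoid_def by blast
qed

end
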